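(* Let $f,g\in\mathbb{C}(z)$ be non-constant rational functions such that $h(z)=f(g(z))\in\mathbb{R}(z)$ and $h$ is weakly injective on $\mathbb{R}$. Then there is a linear fractional function $\lambda\in\mathbb{C}(z)$ such that $\lambda\circ g\in\mathbb{R}(z)$.
   Context: $\hat{\mathbb{C}}=\mathbb{C}\cup\{\infty\}$ is the Riemann sphere and $\hat{\mathbb{R}}=\mathbb{R}\cup\{\infty\}\subset\hat{\mathbb{C}}$; rational functions are regarded as maps $\hat{\mathbb{C}}\to\hat{\mathbb{C}}$. A linear fractional function is $\lambda(z)=\frac{az+b}{cz+d}\in\mathbb{C}(z)$ with $ad-bc\neq0$. A rational function $h\in\mathbb{R}(z)$ is called weakly injective on $\mathbb{R}$ if there exists $z_0\in\mathbb{R}$ which is not a critical point of $h$ (i.e. $h:\hat{\mathbb{C}}\to\hat{\mathbb{C}}$ is unramified, that is locally injective, at $z_0$) and such that there is no $y_0\in\hat{\mathbb{R}}$ with $y_0\neq z_0$ and $h(y_0)=h(z_0)$. *)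

theory Defs
  imports
    "HOL-Analysis.Analysis"
    "HOL-Computational_Algebra.Computational_Algebra"
    "HOL-Computational_Algebra.Field_as_Ring"
begin

text \<open>
  The field \<open>\<complex>(z)\<close> is the type \<^typ>\<open>complex poly fract\<close>. The Riemann sphere is
  \<^typ>\<open>complex option\<close>, with \<^const>\<open>None\<close> as the point at infinity, topologised as the
  one-point compactification of the complex plane.
\<close>

abbreviation riemann_sphere :: "complex option topology" where
  "riemann_sphere \<equiv> Alexandroff_compactification euclidean"

definition extended_reals :: "complex option set" where
  "extended_reals = insert None (Some ` \<real>)"

abbreviation const_ratfun :: "complex \<Rightarrow> complex poly fract" where
  "const_ratfun c \<equiv> to_fract [:c:]"

definition real_ratfuns :: "complex poly fract set" where
  "real_ratfuns =
    {Fract (map_poly complex_of_real p) (map_poly complex_of_real q) | p q :: real poly. q \<noteq> 0}"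

text \<open>
  Substitution of \<open>g\<close> for the variable in \<open>f\<close>, computed in the field \<open>\<complex>(z)\<close>. For non-constant
  \<open>g\<close> the denominator is nonzero, \<open>g\<close> being transcendental over \<open>\<complex>\<close>; for constant \<open>g\<close>
  at a pole of \<open>f\<close> the value is the meaningless \<open>0\<close>.
\<close>

definition ratfun_compose ::
  "complex poly fract \<Rightarrow> complex poly fract \<Rightarrow> complex poly fract" where
  "ratfun_compose f g =
    (case quot_of_fract f of (p, q) \<Rightarrow>
      poly (map_poly const_ratfun p) g / poly (map_poly const_ratfun q) g)"

text \<open>
  The map of the Riemann sphere induced by a rational function. Since \<^const>\<open>quot_of_fract\<close>
  yields the numerator and denominator in lowest terms, a zero of the denominator is a pole. If
  \<open>degree p \<le> degree q\<close>, the value at infinity is the quotient of the coefficients of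
  \<open>z ^ degree q\<close>, which is \<open>0\<close> when the inequality is strict.
\<close>

definition ratfun_map :: "complex poly fract \<Rightarrow> complex option \<Rightarrow> complex option" where
  "ratfun_map r x =
    (case quot_of_fract r of (p, q) \<Rightarrow>
      (case x of
        Some z \<Rightarrow> if poly q z = 0 then None else Some (poly p z / poly q z)
      | None \<Rightarrow>
          if degree p > degree q then None else Some (coeff p (degree q) / lead_coeff q)))"

definition critical_point :: "complex poly fract \<Rightarrow> complex option \<Rightarrow> bool" where
  "critical_point r x \<longleftrightarrow>
    \<not> (\<exists>U. openin riemann_sphere U \<and> x \<in> U \<and> inj_on (ratfun_map r) U)"

definition weakly_injective :: "complex poly fract \<Rightarrow> bool" where
  "weakly_injective h \<longleftrightarrow>
    (\<exists>z\<^sub>0 \<in> Some ` \<real>. \<not> critical_point h z\<^sub>0 \<and>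
      \<not> (\<exists>y\<^sub>0 \<in> extended_reals. y\<^sub>0 \<noteq> z\<^sub>0 \<and> ratfun_map h y\<^sub>0 = ratfun_map h z\<^sub>0))"

definition linear_fractional :: "complex poly fract \<Rightarrow> bool" where
  "linear_fractional l \<longleftrightarrow>
    (\<exists>a b c d. a * d - b * c \<noteq> 0 \<and> l = Fract [:b, a:] [:d, c:])"

end

theory Submission
  imports Defs "HOL-Complex_Analysis.Conformal_Mappings"
begin

text \<open>
  Write \<open>h = f \<circ> g\<close> and let \<open>z\<^sub>0\<close> be the real point given by weak injectivity. By compactness of the
  real projective line, every real \<open>x\<close> close to \<open>z\<^sub>0\<close> is still the only real point in its fibre
  \<open>X = {z. h z = h x}\<close> (\<open>weakly_injective_nearby\<close>). As \<open>h\<close> is real, complex conjugation permutes \<open>X\<close>,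
  and \<open>x\<close> is its only fixed point there.

  The heart of the proof is that the block \<open>{z. g z = g x}\<close> of \<open>X\<close> is stable under conjugation
  (\<open>block_cnj_invariant\<close>). Outside finitely many values both \<open>f\<close> and \<open>h\<close> are covering maps. If
  \<open>g y = g x\<close>, join \<open>x\<close> to \<open>y\<close> by a path; the monodromy \<open>\<phi>\<close> of its image under \<open>h\<close> permutes
  \<open>X\<close>, sends \<open>x\<close> to \<open>y\<close>, and respects the partition of \<open>X\<close> into the fibres of \<open>g\<close>, since
  \<open>g\<close> maps lifts through \<open>h\<close> to lifts through \<open>f\<close>. The complex conjugate of \<open>\<phi>\<close> is the monodromy of the
  conjugate path, so it respects this partition too. Conjugation \<open>c\<close> and \<open>\<phi> \<circ> c \<circ> \<phi>\<inverse>\<close> are two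
  involutions of \<open>X\<close>, with unique fixed points \<open>x\<close> and \<open>y\<close>. Applied alternately,
  starting at \<open>x\<close>, they trace a finite path through \<open>X\<close> without returning; such a path
  ends only at fixed points, so it runs from \<open>x\<close> to \<open>y\<close>. Thus \<open>y\<close> is \<open>d ^ k x\<close> for
  \<open>d = \<phi> \<circ> c \<circ> \<phi>\<inverse> \<circ> c\<close>, and \<open>c y\<close> is \<open>d ^ (-k) x\<close>. As \<open>d\<close> respects the
  partition and \<open>d ^ k x\<close> lies in the block of \<open>x\<close>, so does \<open>d ^ (-k) x\<close>
  (\<open>unique_fixed_point_conjugation\<close>).

  Hence, for \<open>g = p / q\<close> in lowest terms and \<open>w = g x\<close>, the roots of the polynomial \<open>p - w q\<close>, which are
  simple for generic \<open>x\<close>, are closed under conjugation, and the polynomial is a constant multiple of a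
  real one. Two such points with different values \<open>u\<close> and \<open>v\<close> of \<open>g\<close> show that
  \<open>(g - u) / (g - v)\<close> is a constant multiple of a real rational function, and the constant can be
  absorbed into \<open>\<lambda>\<close>.
\<close>

section \<open>Values of rational functions at complex points\<close>

abbreviation num :: "complex poly fract \<Rightarrow> complex poly" where
  "num r \<equiv> fst (quot_of_fract r)"

abbreviation den :: "complex poly fract \<Rightarrow> complex poly" where
  "den r \<equiv> snd (quot_of_fract r)"

text \<open>
  At a pole the value is \<open>0\<close>, by division by zero; statements about values carry the condition
  that the denominator does not vanish, or hold only for all but finitely many points.
\<close>

definition ratfun_eval :: "complex poly fract \<Rightarrow> complex \<Rightarrow> complex" where
  "ratfun_eval r z = poly (num r) z / poly (den r) z"

lemma num_den_no_common_root:
  "poly (num r) z \<noteq> 0 \<or> poly (den r) z \<noteq> 0"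
  using coprime_quot_of_fract[of r] coprime_poly_0 by blast

lemma
  assumes "poly b z \<noteq> 0"
  shows den_Fract_nonzero: "poly (den (Fract a b)) z \<noteq> 0"
    and ratfun_eval_Fract: "ratfun_eval (Fract a b) z = poly a z / poly b z"
proof -
  let ?r = "Fract a b"
  have "Fract (num ?r) (den ?r) = Fract a b"
    by (rule Fract_quot_of_fract)
  moreover have "b \<noteq> 0" using assms by auto
  ultimately have "num ?r * b = a * den ?r"
    by (metis eq_fract(1) snd_quot_of_fract_nonzero)
  then have eq: "poly (num ?r) z * poly b z = poly a z * poly (den ?r) z"
    by (metis poly_mult)
  with assms num_den_no_common_root[of ?r z] show "poly (den ?r) z \<noteq> 0"
    by auto
  with eq assms show "ratfun_eval ?r z = poly a z / poly b z"
    by (simp add: ratfun_eval_def frac_eq_eq)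
qed

lemma MOST_poly_nonzero:
  fixes p :: "complex poly"
  assumes "p \<noteq> 0"
  shows "MOST z. poly p z \<noteq> 0"
  using poly_roots_finite[OF assms] by (simp add: MOST_iff_finiteNeg)

lemma ratfun_eval_const: "ratfun_eval (const_ratfun c) z = c"
  using ratfun_eval_Fract[of 1 z "[:c:]"] by (simp add: to_fract_def)

text \<open>
  Evaluation is a ring homomorphism only away from poles, since \<open>r\<close> and \<open>s\<close> may
  have poles that cancel. Quantifying with \<open>MOST\<close> discards these finitely many points and makes such
  identities composable.
\<close>

lemma MOST_ratfun_eval_add:
  "MOST z. ratfun_eval (r + s) z = ratfun_eval r z + ratfun_eval s z"
proof -
  obtain a b c d where r: "r = Fract a b" "b \<noteq> 0" and s: "s = Fract c d" "d \<noteq> 0"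
    by (metis Fract_cases)
  have "MOST z. poly b z \<noteq> 0 \<and> poly d z \<noteq> 0"
    using r s by (simp add: MOST_conj_distrib MOST_poly_nonzero)
  then show ?thesis
    by (rule MOST_mono) (simp add: r s ratfun_eval_Fract add_frac_eq)
qed

lemma MOST_ratfun_eval_mult:
  "MOST z. ratfun_eval (r * s) z = ratfun_eval r z * ratfun_eval s z"
proof -
  obtain a b c d where r: "r = Fract a b" "b \<noteq> 0" and s: "s = Fract c d" "d \<noteq> 0"
    by (metis Fract_cases)
  have "MOST z. poly b z \<noteq> 0 \<and> poly d z \<noteq> 0"
    using r s by (simp add: MOST_conj_distrib MOST_poly_nonzero)
  then show ?thesis
    by (rule MOST_mono) (simp add: r s ratfun_eval_Fract)
qed

lemma MOST_ratfun_eval_divide: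
  "MOST z. ratfun_eval (r / s) z = ratfun_eval r z / ratfun_eval s z"
proof (cases "s = 0")
  case True
  then show ?thesis
    by (simp add: ratfun_eval_def)
next
  case False
  obtain a b c d where r: "r = Fract a b" "b \<noteq> 0" and s: "s = Fract c d" "d \<noteq> 0"
    by (metis Fract_cases)
  with False have "c \<noteq> 0"
    by (metis fract_collapse(1))
  then have "MOST z. poly b z \<noteq> 0 \<and> poly d z \<noteq> 0 \<and> poly c z \<noteq> 0"
    using r s by (simp add: MOST_conj_distrib MOST_poly_nonzero)
  then show ?thesis
    by (rule MOST_mono) (simp add: r s ratfun_eval_Fract)
qed

lemma map_poly_const_ratfun_pCons:
  "map_poly const_ratfun (pCons a p) = pCons (const_ratfun a) (map_poly const_ratfun p)"
  by (rule map_poly_pCons) simp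

lemma MOST_ratfun_eval_poly:
  "MOST z. ratfun_eval (poly (map_poly const_ratfun p) g) z = poly p (ratfun_eval g z)"
proof (induction p)
  case 0
  then show ?case by (simp add: ratfun_eval_def)
next
  case (pCons a p)
  let ?P = "poly (map_poly const_ratfun p) g"
  have "MOST z. ratfun_eval (const_ratfun a + g * ?P) z
          = ratfun_eval (const_ratfun a) z + ratfun_eval (g * ?P) z"
    by (rule MOST_ratfun_eval_add)
  moreover have "MOST z. ratfun_eval (g * ?P) z = ratfun_eval g z * ratfun_eval ?P z"
    by (rule MOST_ratfun_eval_mult)
  ultimately have "MOST z. ratfun_eval (const_ratfun a + g * ?P) z
          = a + ratfun_eval g z * poly p (ratfun_eval g z)"
    using pCons.IH by eventually_elim (simp add: ratfun_eval_const)
  then show ?case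
    by (simp add: map_poly_const_ratfun_pCons)
qed

text \<open>
  Links the algebraic substitution in \<open>\<complex>(z)\<close> to composition of functions; all that follows
  uses only this pointwise form.
\<close>

lemma MOST_ratfun_eval_compose:
  "MOST z. ratfun_eval (ratfun_compose f g) z = ratfun_eval f (ratfun_eval g z)"
proof -
  let ?S = "\<lambda>p. poly (map_poly const_ratfun p) g"
  have "MOST z. ratfun_eval (?S (num f) / ?S (den f)) z
          = ratfun_eval (?S (num f)) z / ratfun_eval (?S (den f)) z"
    by (rule MOST_ratfun_eval_divide)
  with MOST_ratfun_eval_poly[of "num f" g] MOST_ratfun_eval_poly[of "den f" g]
  have "MOST z. ratfun_eval (?S (num f) / ?S (den f)) z = ratfun_eval f (ratfun_eval g z)"
    by eventually_elim (simp add: ratfun_eval_def[of f])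
  then show ?thesis
    by (simp add: ratfun_compose_def case_prod_beta)
qed

lemma ratfun_eqI:
  assumes "MOST z. ratfun_eval r z = ratfun_eval s z"
  shows "r = s"
proof -
  have "MOST z. poly (den r) z \<noteq> 0" "MOST z. poly (den s) z \<noteq> 0"
    by (simp_all add: MOST_poly_nonzero)
  with assms have "MOST z. poly (num r * den s - num s * den r) z = 0"
    by eventually_elim (simp add: ratfun_eval_def frac_eq_eq)
  then have "infinite {z. poly (num r * den s - num s * den r) z = 0}"
    using MOST_INFM[OF infinite_UNIV_char_0] by (simp only: INFM_iff_infinite)
  then have "num r * den s = num s * den r"
    using poly_roots_finite[of "num r * den s - num s * den r"] by auto
  then have "Fract (num r) (den r) = Fract (num s) (den s)"
    by (metis eq_fract(1) snd_quot_of_fract_nonzero)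
  then show ?thesis by simp
qed

definition level_poly :: "complex poly fract \<Rightarrow> complex \<Rightarrow> complex poly" where
  "level_poly r t = num r - smult t (den r)"

lemma level_poly_root_iff:
  "poly (level_poly r t) z = 0 \<longleftrightarrow> poly (den r) z \<noteq> 0 \<and> ratfun_eval r z = t"
  using num_den_no_common_root[of r z] by (auto simp: level_poly_def ratfun_eval_def field_simps)

lemma level_poly_nonzero:
  assumes "r \<notin> range const_ratfun"
  shows "level_poly r t \<noteq> 0"
proof
  assume "level_poly r t = 0"
  then have "num r = [:t:] * den r"
    by (simp add: level_poly_def)
  then have "r = Fract ([:t:] * den r) (1 * den r)"
    by (metis Fract_quot_of_fract mult_1)
  also have "\<dots> = const_ratfun t"
    by (simp add: to_fract_def eq_fract)
  finally show False using assms by blast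
qed

lemma MOST_ratfun_eval_neq:
  assumes "r \<notin> range const_ratfun"
  shows "MOST z. ratfun_eval r z \<noteq> t"
proof -
  have "MOST z. poly (level_poly r t) z \<noteq> 0 \<and> poly (den r) z \<noteq> 0"
    using level_poly_nonzero[OF assms] by (simp add: MOST_conj_distrib MOST_poly_nonzero)
  then show ?thesis
    by (rule MOST_mono) (auto simp: level_poly_root_iff)
qed

lemma MOST_ratfun_eval_notin:
  assumes "r \<notin> range const_ratfun" "finite F"
  shows "MOST z. ratfun_eval r z \<notin> F"
proof -
  have "MOST z. \<forall>t\<in>F. ratfun_eval r z \<noteq> t"
    using assms by (simp add: eventually_ball_finite_distrib MOST_ratfun_eval_neq)
  then show ?thesis
    by (rule MOST_mono) auto
qed

section \<open>Rational functions as covering maps\<close>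

text \<open>
  Besides the critical values, this excludes a finite value taken at infinity, where the degree drops
  because a point of the fibre has escaped from the plane.
\<close>

definition generic_value :: "complex poly fract \<Rightarrow> complex \<Rightarrow> bool" where
  "generic_value r t \<longleftrightarrow>
    rsquarefree (level_poly r t) \<and> degree (level_poly r t) = max (degree (num r)) (degree (den r))"

lemma nonconst_degree:
  assumes "r \<notin> range const_ratfun"
  shows "degree (num r) > 0 \<or> degree (den r) > 0"
proof (rule ccontr)
  assume "\<not> ?thesis"
  then obtain a b where ab: "num r = [:a:]" "den r = [:b:]"
    by (metis bot_nat_0.not_eq_extremum degree_eq_zeroE)
  then have "b \<noteq> 0"
    by (metis pCons_0_0 snd_quot_of_fract_nonzero)
  have "r = Fract [:a:] [:b:]"
    by (metis ab Fract_quot_of_fract)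
  also have "\<dots> = const_ratfun (a / b)"
    using \<open>b \<noteq> 0\<close> by (simp add: to_fract_def eq_fract)
  finally show False using assms by blast
qed

text \<open>
  If the numerator of the derivative vanished, the denominator, being coprime to the numerator, would divide
  its own derivative, hence be constant; then the numerator would be constant as well.
\<close>

lemma wronskian_nonzero:
  assumes "r \<notin> range const_ratfun"
  shows "pderiv (num r) * den r - num r * pderiv (den r) \<noteq> 0"
proof
  assume "pderiv (num r) * den r - num r * pderiv (den r) = 0"
  then have eq: "pderiv (num r) * den r = num r * pderiv (den r)"
    by simp
  then have "den r dvd num r * pderiv (den r)"
    by (metis dvd_triv_right)
  then have "den r dvd pderiv (den r)"
    using coprime_quot_of_fract[of r] by (simp add: coprime_commute coprime_dvd_mult_right_iff)
  then have "degree (den r) = 0"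
    using not_dvd_pderiv by blast
  then have "pderiv (den r) = 0"
    by (simp add: pderiv_eq_0_iff)
  with eq have "pderiv (num r) = 0"
    by simp
  then have "degree (num r) = 0"
    by (simp add: pderiv_eq_0_iff)
  with \<open>degree (den r) = 0\<close> nonconst_degree[OF assms] show False
    by simp
qed

lemma finite_nongeneric_values:
  assumes "r \<notin> range const_ratfun"
  shows "finite {t. \<not> generic_value r t}"
proof (rule finite_subset)
  let ?w = "pderiv (num r) * den r - num r * pderiv (den r)"
  let ?n = "max (degree (num r)) (degree (den r))"
  let ?s = "coeff (num r) ?n / coeff (den r) ?n"
  show "finite (insert ?s (ratfun_eval r ` {z. poly ?w z = 0}))"
    using poly_roots_finite[OF wronskian_nonzero[OF assms]] by simp
  show "{t. \<not> generic_value r t} \<subseteq> insert ?s (ratfun_eval r ` {z. poly ?w z = 0})"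
  proof
    fix t assume "t \<in> {t. \<not> generic_value r t}"
    then consider "\<not> rsquarefree (level_poly r t)" | "degree (level_poly r t) \<noteq> ?n"
      by (auto simp: generic_value_def)
    then show "t \<in> insert ?s (ratfun_eval r ` {z. poly ?w z = 0})"
    proof cases
      case 1
      then obtain z where z: "poly (level_poly r t) z = 0" "poly (pderiv (level_poly r t)) z = 0"
        by (auto simp: rsquarefree_roots)
      then have "poly (pderiv (num r)) z = t * poly (pderiv (den r)) z"
        and "poly (num r) z = t * poly (den r) z"
        by (simp_all add: level_poly_def pderiv_diff pderiv_smult)
      then have "poly ?w z = 0"
        by simp
      moreover have "t = ratfun_eval r z"
        using z by (simp add: level_poly_root_iff)
      ultimately show ?thesis by blast
    next
      case 2
      have "degree (level_poly r t) \<le> ?n"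
        unfolding level_poly_def by (intro degree_diff_le) (auto simp: degree_smult_le intro: order_trans[OF degree_smult_le])
      with 2 have "coeff (level_poly r t) ?n = 0"
        by (intro coeff_eq_0) simp
      then have eq: "coeff (num r) ?n = t * coeff (den r) ?n"
        by (simp add: level_poly_def)
      have "coeff (den r) ?n \<noteq> 0"
      proof
        assume 0: "coeff (den r) ?n = 0"
        with eq have "coeff (num r) ?n = 0" by simp
        with 0 show False
        proof (cases "degree (num r) \<le> degree (den r)")
          case True
          with 0 show ?thesis by (simp add: max_def)
        next
          case False
          with \<open>coeff (num r) ?n = 0\<close> have "num r = 0" by (simp add: max_def)
          with False show ?thesis by simp
        qed
      qed
      with eq show ?thesis by simp
    qed
  qed
qed

definition ratfun_preimage :: "complex poly fract \<Rightarrow> complex set \<Rightarrow> complex set" where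
  "ratfun_preimage r T = {z. poly (den r) z \<noteq> 0 \<and> ratfun_eval r z \<in> T}"

lemma open_den_nonzero: "open {z. poly (den r) z \<noteq> 0}"
  by (intro open_Collect_neq continuous_intros)

lemma holomorphic_ratfun_eval: "ratfun_eval r holomorphic_on {z. poly (den r) z \<noteq> 0}"
  unfolding ratfun_eval_def[abs_def] by (intro holomorphic_intros) auto

lemma open_ratfun_preimage:
  assumes "open T"
  shows "open (ratfun_preimage r T)"
proof -
  have "open (ratfun_eval r -` T \<inter> {z. poly (den r) z \<noteq> 0})"
    using holomorphic_on_imp_continuous_on[OF holomorphic_ratfun_eval] open_den_nonzero assms
    by (metis continuous_on_open_vimage)
  moreover have "ratfun_preimage r T = ratfun_eval r -` T \<inter> {z. poly (den r) z \<noteq> 0}"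
    by (auto simp: ratfun_preimage_def)
  ultimately show ?thesis by simp
qed

lemma holomorphic_on_ratfun_preimage: "ratfun_eval r holomorphic_on ratfun_preimage r T"
  by (rule holomorphic_on_subset[OF holomorphic_ratfun_eval]) (auto simp: ratfun_preimage_def)

lemma generic_value_deriv_nonzero:
  assumes "generic_value r t" "poly (level_poly r t) z = 0"
  shows "deriv (ratfun_eval r) z \<noteq> 0"
proof -
  have den: "poly (den r) z \<noteq> 0" and ev: "ratfun_eval r z = t"
    using assms by (auto simp: level_poly_root_iff)
  then have num: "poly (num r) z = t * poly (den r) z"
    by (auto simp: ratfun_eval_def field_simps)
  have "(ratfun_eval r has_field_derivative
          (poly (pderiv (num r)) z * poly (den r) z - poly (num r) z * poly (pderiv (den r)) z)
            / (poly (den r) z * poly (den r) z)) (at z)"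
    unfolding ratfun_eval_def[abs_def] using den
    by (auto intro!: derivative_eq_intros)
  moreover have "poly (pderiv (level_poly r t)) z \<noteq> 0"
    using assms by (auto simp: generic_value_def rsquarefree_roots)
  then have "poly (pderiv (num r)) z \<noteq> t * poly (pderiv (den r)) z"
    by (simp add: level_poly_def pderiv_diff pderiv_smult)
  ultimately show ?thesis
    using den num by (auto dest!: DERIV_imp_deriv)
qed

lemma card_fibre:
  assumes "generic_value r t"
  shows "card {z. poly (level_poly r t) z = 0} = max (degree (num r)) (degree (den r))"
proof -
  let ?F = "level_poly r t"
  have rs: "rsquarefree ?F" using assms by (simp add: generic_value_def)
  then have "?F \<noteq> 0" by (auto simp: rsquarefree_def)
  have "degree ?F = degree (smult (lead_coeff ?F) (\<Prod>z|poly ?F z = 0. [:- z, 1:]))"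
    using complex_poly_decompose_rsquarefree[OF rs] by simp
  also have "\<dots> = card {z. poly ?F z = 0}"
    using \<open>?F \<noteq> 0\<close> by (simp add: degree_prod_eq_sum_degree)
  finally show ?thesis
    using assms by (simp add: generic_value_def)
qed


text \<open>
  Around each of the \<open>n\<close> points of the fibre over \<open>t\<close>, the function is injective, which gives
  \<open>n\<close> disjoint sheets over a common neighbourhood \<open>V\<close> of \<open>t\<close>. Properness is replaced by counting: a fibre
  over \<open>V\<close> already has \<open>n\<close> points in these sheets, and it has no more than \<open>n\<close> points.
\<close>

lemma covering_space_ratfun_eval:
  assumes r: "r \<notin> range const_ratfun" and "open T" and generic: "\<And>t. t \<in> T \<Longrightarrow> generic_value r t"
  shows "covering_space (ratfun_preimage r T) (ratfun_eval r) T"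
proof
  let ?n = "max (degree (num r)) (degree (den r))"
  let ?D = "ratfun_preimage r T"
  let ?fib = "\<lambda>t. {z. poly (level_poly r t) z = 0}"
  have fib_iff: "z \<in> ?fib t \<longleftrightarrow> z \<in> ?D \<and> ratfun_eval r z = t" if "t \<in> T" for t z
    using that by (auto simp: level_poly_root_iff ratfun_preimage_def)
  have fin_fib: "finite (?fib t)" for t
    using level_poly_nonzero[OF r] by (rule poly_roots_finite)
  have fib_nonempty: "?fib t \<noteq> {}" if "t \<in> T" for t
  proof -
    have "card (?fib t) > 0"
      using card_fibre[OF generic[OF that]] nonconst_degree[OF r] by (simp add: less_max_iff_disj)
    then show ?thesis by (metis card.empty less_irrefl)
  qed
  show cont: "continuous_on ?D (ratfun_eval r)"
    by (intro holomorphic_on_imp_continuous_on holomorphic_on_ratfun_preimage)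
  show "ratfun_eval r ` ?D = T"
    using fib_nonempty fib_iff by (fastforce simp: ratfun_preimage_def)
  fix t assume t: "t \<in> T"
  let ?R = "?fib t"
  have "\<exists>e>0. ball a e \<subseteq> ?D \<and> inj_on (ratfun_eval r) (ball a e)" if "a \<in> ?R" for a
  proof -
    have "deriv (ratfun_eval r) a \<noteq> 0"
      using generic_value_deriv_nonzero[OF generic[OF t]] that by simp
    moreover have "a \<in> ?D"
      using that t fib_iff by blast
    ultimately show ?thesis
      using has_complex_derivative_locally_injective[OF holomorphic_on_ratfun_preimage _ open_ratfun_preimage[OF \<open>open T\<close>]]
      by metis
  qed
  then obtain e where e: "\<And>a. a \<in> ?R \<Longrightarrow> e a > 0 \<and> ball a (e a) \<subseteq> ?D \<and> inj_on (ratfun_eval r) (ball a (e a))"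
    by metis
  have "\<exists>d>0. \<forall>b\<in>?R. b \<noteq> a \<longrightarrow> d \<le> dist a b" for a
    using finite_set_avoid[OF fin_fib] by blast
  then obtain d where d: "\<And>a. d a > 0" "\<And>a b. b \<in> ?R \<Longrightarrow> b \<noteq> a \<Longrightarrow> d a \<le> dist a b"
    by metis
  (* Half the distance to the nearest other point of the fibre makes these discs disjoint. *)
  define U where "U = (\<lambda>a. ball a (min (e a) (d a / 2)))"
  have U: "U a \<subseteq> ?D" "inj_on (ratfun_eval r) (U a)" "a \<in> U a" "open (U a)" if "a \<in> ?R" for a
  proof -
    have "U a \<subseteq> ball a (e a)" by (auto simp: U_def)
    then show "U a \<subseteq> ?D" "inj_on (ratfun_eval r) (U a)"
      using e[OF that] by (blast, blast intro: inj_on_subset)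
    show "a \<in> U a" "open (U a)"
      using e[OF that] d(1)[of a] by (simp_all add: U_def)
  qed
  have U_disjoint: "U a \<inter> U b = {}" if "a \<in> ?R" "b \<in> ?R" "a \<noteq> b" for a b
  proof -
    have "d a \<le> dist a b" "d b \<le> dist a b"
      using d(2)[of b a] d(2)[of a b] that by (auto simp: dist_commute)
    then have "min (e a) (d a / 2) + min (e b) (d b / 2) \<le> dist a b"
      by (auto simp: min_def)
    then show ?thesis
      unfolding U_def by (rule disjoint_ballI)
  qed
  have U_image_open: "open (ratfun_eval r ` U a)" if "a \<in> ?R" for a
    using U[OF that] open_mapping_thm3 holomorphic_on_subset[OF holomorphic_on_ratfun_preimage] by blast
  define V where "V = (\<Inter>a\<in>?R. ratfun_eval r ` U a)"
  have "open V"
    unfolding V_def using fin_fib U_image_open by (intro open_INT) auto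
  have "t \<in> V"
    unfolding V_def using U(3) t fib_iff by force
  have "V \<subseteq> T"
    unfolding V_def using fib_nonempty[OF t] U(1) by (fastforce simp: ratfun_preimage_def)
  define W where "W = (\<lambda>a. U a \<inter> ratfun_eval r -` V)"
  have W_image: "ratfun_eval r ` W a = V" if "a \<in> ?R" for a
  proof -
    have "V \<subseteq> ratfun_eval r ` U a"
      using that unfolding V_def by blast
    then show ?thesis
      by (auto simp: W_def)
  qed
  have W_open: "open (W a)" if "a \<in> ?R" for a
    unfolding W_def using U[OF that] \<open>open V\<close> cont
    by (metis Int_commute continuous_on_open_vimage continuous_on_subset)
  have W_union: "\<Union>(W ` ?R) = ?D \<inter> ratfun_eval r -` V"
  proof
    show "\<Union>(W ` ?R) \<subseteq> ?D \<inter> ratfun_eval r -` V"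
      using U(1) by (auto simp: W_def)
    show "?D \<inter> ratfun_eval r -` V \<subseteq> \<Union>(W ` ?R)"
    proof
      fix z assume z: "z \<in> ?D \<inter> ratfun_eval r -` V"
      define s where "s = ratfun_eval r z"
      have s: "s \<in> V" "s \<in> T" "z \<in> ?fib s"
        using z \<open>V \<subseteq> T\<close> fib_iff[of s z] by (auto simp: s_def)
      then have "\<forall>a\<in>?R. \<exists>y. y \<in> U a \<and> ratfun_eval r y = s"
        by (auto simp: V_def)
      then obtain y where y: "\<And>a. a \<in> ?R \<Longrightarrow> y a \<in> U a \<and> ratfun_eval r (y a) = s"
        by metis
      have "inj_on y ?R"
        by (rule inj_onI) (metis U_disjoint y disjoint_iff)
      then have "card (y ` ?R) = ?n"
        using card_fibre[OF generic[OF t]] by (simp add: card_image)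
      moreover have "y ` ?R \<subseteq> ?fib s"
        using y U(1) fib_iff[OF \<open>s \<in> T\<close>] by blast
      ultimately have "y ` ?R = ?fib s"
        using card_fibre[OF generic[OF \<open>s \<in> T\<close>]] fin_fib by (metis card_subset_eq)
      with s obtain a where "a \<in> ?R" "z = y a"
        by blast
      with y s(1) show "z \<in> \<Union>(W ` ?R)"
        by (auto simp: W_def)
    qed
  qed
  show "\<exists>V. t \<in> V \<and> openin (top_of_set T) V \<and>
          (\<exists>v. \<Union>v = ?D \<inter> ratfun_eval r -` V \<and> (\<forall>u\<in>v. openin (top_of_set ?D) u) \<and>
            pairwise disjnt v \<and> (\<forall>u\<in>v. \<exists>q. homeomorphism u V (ratfun_eval r) q))"
  proof (intro exI[of _ V] exI[of _ "W ` ?R"] conjI ballI)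
    show "t \<in> V" by fact
    show "openin (top_of_set T) V"
      using \<open>open V\<close> \<open>V \<subseteq> T\<close> by (simp add: open_subset)
    show "\<Union>(W ` ?R) = ?D \<inter> ratfun_eval r -` V" by fact
    show "pairwise disjnt (W ` ?R)"
      using U_disjoint by (fastforce simp: pairwise_def disjnt_def W_def)
  next
    fix u assume "u \<in> W ` ?R"
    then obtain a where a: "a \<in> ?R" "u = W a" by blast
    then have "u \<subseteq> ?D" using W_union by blast
    then show "openin (top_of_set ?D) u"
      using W_open a by (simp add: open_subset)
    show "\<exists>q. homeomorphism u V (ratfun_eval r) q"
    proof -
      have "continuous_on u (ratfun_eval r)"
        using cont \<open>u \<subseteq> ?D\<close> continuous_on_subset by blast
      moreover have "inj_on (ratfun_eval r) u"
        using U(2)[OF a(1)] a(2) by (auto simp: W_def intro: inj_on_subset)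
      ultimately show ?thesis
        using invariance_of_domain_homeomorphism[of u "ratfun_eval r"] W_open W_image a
        by (metis order_refl)
    qed
  qed
qed

section \<open>An involution with one fixed point\<close>

text \<open>
  The permutation \<open>d = (\<phi> \<circ> c \<circ> \<phi>\<inverse>) \<circ> c\<close> is a product of two involutions, so \<open>c\<close> conjugates it
  to its inverse and maps \<open>d ^ i x\<close> to \<open>d ^ (-i) x\<close>. The orbit of \<open>x\<close> under \<open>d\<close> has odd
  length \<open>2 m + 1\<close>, since otherwise its midpoint would be another fixed point of \<open>c\<close>. Then
  \<open>d ^ (m + 1) x\<close> is fixed by \<open>\<phi> \<circ> c \<circ> \<phi>\<inverse>\<close>, so it equals \<open>\<phi> x\<close>, and
  \<open>c (\<phi> x) = d ^ m x\<close>. Finally \<open>d ^ m\<close> carries the \<open>g\<close>-equivalent points \<open>\<phi> x\<close> and \<open>x\<close> to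
  \<open>x\<close> and \<open>d ^ m x\<close>. In terms of groups: a block containing \<open>x\<close> is stable under an involution that
  normalizes the group and fixes only \<open>x\<close>.
\<close>

lemma unique_fixed_point_conjugation:
  fixes c \<phi> :: "'a \<Rightarrow> 'a"
  assumes "finite X" and \<phi>: "\<phi> permutes X"
    and c: "\<And>z. c (c z) = z" and cX: "\<And>z. z \<in> X \<Longrightarrow> c z \<in> X"
    and x: "x \<in> X" "c x = x" and uniq: "\<And>z. z \<in> X \<Longrightarrow> c z = z \<Longrightarrow> z = x"
    and g\<phi>: "\<And>z z'. z \<in> X \<Longrightarrow> z' \<in> X \<Longrightarrow> g (\<phi> z) = g (\<phi> z') \<longleftrightarrow> g z = g z'"
    and gc: "\<And>z z'. z \<in> X \<Longrightarrow> z' \<in> X \<Longrightarrow> g (c (\<phi> (c z))) = g (c (\<phi> (c z'))) \<longleftrightarrow> g z = g z'"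
    and gx: "g (\<phi> x) = g x"
  shows "g (c (\<phi> x)) = g x"
proof -
  define d where "d = (\<lambda>z. \<phi> (c (inv \<phi> (c z))))"
  have \<phi>_inv: "\<phi> (inv \<phi> z) = z" "inv \<phi> (\<phi> z) = z" for z
    using \<phi> by (simp_all add: permutes_inverses)
  have \<phi>_mem: "\<phi> z \<in> X" "inv \<phi> z \<in> X" if "z \<in> X" for z
    using that \<phi> by (simp_all add: permutes_in_image permutes_inv)
  have d_mem: "d z \<in> X" if "z \<in> X" for z
    using that by (simp add: d_def \<phi>_mem cX)
  have d_pow_mem: "(d ^^ i) x \<in> X" for i
    by (induction i) (auto simp: x d_mem)
  (* In group terms: c d c is the inverse of d. *)
  have dcd: "d (c (d z)) = c z" for z
    by (simp add: d_def c \<phi>_inv)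
  have "inj d"
    by (rule injI) (metis dcd c)
  then have inj_pow: "inj (d ^^ i)" for i
    by (induction i) (auto intro: inj_compose)
  have dcd_pow: "(d ^^ i) (c ((d ^^ i) z)) = c z" for i z
  proof (induction i arbitrary: z)
    case (Suc i)
    have "(d ^^ Suc i) (c ((d ^^ Suc i) z)) = d ((d ^^ i) (c ((d ^^ i) (d z))))"
      by (simp add: funpow_swap1)
    with Suc show ?case by (simp add: dcd)
  qed simp
  have g_d: "g (d z) = g (d z')" if "z \<in> X" "z' \<in> X" "g z = g z'" for z z'
  proof -
    define u where "u = c (inv \<phi> (c z))"
    define u' where "u' = c (inv \<phi> (c z'))"
    have "u \<in> X" "u' \<in> X"
      using that by (simp_all add: u_def u'_def \<phi>_mem cX)
    moreover have "c (\<phi> (c u)) = z" "c (\<phi> (c u')) = z'"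
      by (simp_all add: u_def u'_def c \<phi>_inv)
    ultimately have "g u = g u'"
      using gc[of u u'] that by simp
    then show ?thesis
      using g\<phi> \<open>u \<in> X\<close> \<open>u' \<in> X\<close> by (simp add: d_def u_def u'_def)
  qed
  have g_d_pow: "g ((d ^^ i) z) = g ((d ^^ i) z')" if "z \<in> X" "z' \<in> X" "g z = g z'" for i z z'
    using that
  proof (induction i arbitrary: z z')
    case (Suc i)
    then show ?case
      using Suc.IH[OF d_mem d_mem g_d, of z z'] by (simp add: funpow_swap1)
  qed simp

  have "\<exists>N>0. (d ^^ N) x = x"
  proof -
    have "\<not> inj (\<lambda>i. (d ^^ i) x)"
      using finite_subset[of "range (\<lambda>i. (d ^^ i) x)" X] \<open>finite X\<close> d_pow_mem
      by (auto dest: finite_imageD)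
    then obtain i j where "i < j" "(d ^^ i) x = (d ^^ j) x"
      by (auto simp: inj_def) (metis linorder_neqE_nat)
    then have "(d ^^ i) ((d ^^ (j - i)) x) = (d ^^ i) x"
      by (metis add_diff_inverse_nat comp_apply funpow_add not_less_iff_gr_or_eq)
    then have "(d ^^ (j - i)) x = x"
      using inj_pow by (meson injD)
    with \<open>i < j\<close> show ?thesis
      by (intro exI[of _ "j - i"]) simp
  qed
  define N where "N = (LEAST N. N > 0 \<and> (d ^^ N) x = x)"
  have N: "N > 0" "(d ^^ N) x = x"
    using LeastI_ex[OF \<open>\<exists>N>0. (d ^^ N) x = x\<close>] by (simp_all add: N_def)
  have N_min: "(d ^^ i) x \<noteq> x" if "0 < i" "i < N" for i
    using not_less_Least[of i "\<lambda>N. N > 0 \<and> (d ^^ N) x = x"] that by (auto simp: N_def)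
  have "odd N"
  proof
    assume "even N"
    then obtain m where m: "N = m + m" by (metis evenE mult_2)
    with N have "(d ^^ m) (c ((d ^^ m) x)) = (d ^^ m) ((d ^^ m) x)"
      by (simp add: dcd_pow x funpow_add)
    then have "c ((d ^^ m) x) = (d ^^ m) x"
      using inj_pow by (meson injD)
    then have "(d ^^ m) x = x"
      by (simp add: uniq d_pow_mem)
    with N_min[of m] N(1) m show False by simp
  qed
  then obtain m where m: "N = m + Suc m" by (metis oddE mult_2 add_Suc_right Suc_eq_plus1)
  have "(d ^^ m) (c ((d ^^ m) x)) = (d ^^ m) ((d ^^ Suc m) x)"
    using N(2) unfolding m funpow_add by (simp add: dcd_pow x)
  then have c_mid: "c ((d ^^ m) x) = (d ^^ Suc m) x"
    using inj_pow by (meson injD)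
  have "inv \<phi> (c ((d ^^ m) x)) = x"
  proof (rule uniq)
    show "inv \<phi> (c ((d ^^ m) x)) \<in> X"
      by (simp add: \<phi>_mem cX d_pow_mem)
    have "\<phi> (c (inv \<phi> (c ((d ^^ m) x)))) = c ((d ^^ m) x)"
      using c_mid by (simp add: d_def)
    then show "c (inv \<phi> (c ((d ^^ m) x))) = inv \<phi> (c ((d ^^ m) x))"
      by (metis \<phi>_inv(2))
  qed
  then have \<phi>x: "\<phi> x = c ((d ^^ m) x)"
    by (metis \<phi>_inv(1))
  have "g ((d ^^ m) (\<phi> x)) = g ((d ^^ m) x)"
    using g_d_pow[OF _ x(1) gx] x(1) by (simp add: \<phi>_mem)
  moreover have "(d ^^ m) (\<phi> x) = x"
    by (simp add: \<phi>x dcd_pow x)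
  ultimately show ?thesis
    by (simp add: \<phi>x c)
qed

section \<open>Monodromy and complex conjugation\<close>

text \<open>
  The permutation moves a point of the fibre to the end of the lift of \<open>p \<circ> \<alpha>\<close> that starts there; the
  lift starting where \<open>\<alpha>\<close> starts is \<open>\<alpha>\<close> itself. Besides the permutation, the lifts are
  recorded, because how \<open>\<phi>\<close> interacts with other maps is read off from them.
\<close>

lemma covering_space_monodromy_permutation:
  fixes p :: "'a::real_normed_vector \<Rightarrow> 'b::real_normed_vector"
  assumes cov: "covering_space C p S" and fin: "finite {z \<in> C. p z = t}"
    and \<alpha>: "path \<alpha>" "path_image \<alpha> \<subseteq> C" "p (pathstart \<alpha>) = t" "p (pathfinish \<alpha>) = t"
  obtains \<phi> where "\<phi> permutes {z \<in> C. p z = t}" "\<phi> (pathstart \<alpha>) = pathfinish \<alpha>"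
    "\<And>z. z \<in> C \<Longrightarrow> p z = t \<Longrightarrow>
       \<exists>\<beta>. path \<beta> \<and> path_image \<beta> \<subseteq> C \<and> pathstart \<beta> = z \<and> pathfinish \<beta> = \<phi> z \<and>
           (\<forall>s\<in>{0..1}. p (\<beta> s) = p (\<alpha> s))"
proof -
  let ?X = "{z \<in> C. p z = t}"
  let ?lift = "\<lambda>\<beta> z. path \<beta> \<and> path_image \<beta> \<subseteq> C \<and> pathstart \<beta> = z \<and> (\<forall>s\<in>{0..1}. p (\<beta> s) = p (\<alpha> s))"
  have unique: "\<beta> s' = \<beta>' s'"
    if "?lift \<beta> z" "?lift \<beta>' z'" "s \<in> {0..1}" "s' \<in> {0..1}" "\<beta> s = \<beta>' s" for \<beta> \<beta>' z z' s s'
  proof (rule covering_space_lift_unique[OF cov, of \<beta> s \<beta>' "{0..1}" "p \<circ> \<alpha>"])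
    show "continuous_on {0..1} (p \<circ> \<alpha>)"
      using \<alpha> covering_space_imp_continuous[OF cov] 
      by (metis continuous_on_compose continuous_on_subset path_def path_image_def)
    show "p \<circ> \<alpha> \<in> {0..1} \<rightarrow> S"
      using \<alpha>(2) covering_space_imp_surjective[OF cov] by (auto simp: path_image_def)
  qed (use that in \<open>auto simp: path_def path_image_def\<close>)
  have "\<exists>\<beta>. ?lift \<beta> z" if "z \<in> ?X" for z
  proof -
    have "path (p \<circ> \<alpha>)"
      using \<alpha> covering_space_imp_continuous[OF cov] 
      by (metis path_continuous_image continuous_on_subset)
    moreover have "path_image (p \<circ> \<alpha>) \<subseteq> S"
      using \<alpha>(2) covering_space_imp_surjective[OF cov] by (auto simp: path_image_def)
    moreover have "pathstart (p \<circ> \<alpha>) = p z"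
      using that \<alpha>(3) by (simp add: pathstart_def)
    ultimately show ?thesis
      using covering_space_lift_path_strong[OF cov, of z "p \<circ> \<alpha>"] that
      by (smt (verit) comp_apply mem_Collect_eq)
  qed
  then obtain L where L: "\<And>z. z \<in> ?X \<Longrightarrow> ?lift (L z) z"
    using bchoice[of ?X "\<lambda>z \<beta>. ?lift \<beta> z"] by blast
  define \<phi> where "\<phi> = (\<lambda>z. if z \<in> ?X then pathfinish (L z) else z)"
  have "pathfinish (L z) \<in> ?X" if "z \<in> ?X" for z
  proof -
    have "pathfinish (L z) \<in> path_image (L z)" by (rule pathfinish_in_path_image)
    moreover have "p (L z 1) = p (\<alpha> 1)" using L[OF that] by simp
    ultimately show ?thesis
      using L[OF that] \<alpha>(4) by (auto simp: pathfinish_def)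
  qed
  then have "\<phi> ` ?X \<subseteq> ?X"
    by (auto simp: \<phi>_def)
  moreover have "inj_on \<phi> ?X"
  proof (rule inj_onI)
    fix z z' assume z: "z \<in> ?X" "z' \<in> ?X" "\<phi> z = \<phi> z'"
    then have "L z 1 = L z' 1"
      by (simp add: \<phi>_def pathfinish_def)
    then have "L z 0 = L z' 0"
      using unique[OF L[OF z(1)] L[OF z(2)], of 1 0] by simp
    then show "z = z'"
      using L[OF z(1)] L[OF z(2)] by (simp add: pathstart_def)
  qed
  ultimately have "bij_betw \<phi> ?X ?X"
    using fin by (simp add: bij_betw_def endo_inj_surj)
  then have "\<phi> permutes ?X"
    by (rule bij_imp_permutes) (simp only: \<phi>_def if_False)
  moreover have "\<phi> (pathstart \<alpha>) = pathfinish \<alpha>"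
  proof -
    have mem: "pathstart \<alpha> \<in> ?X"
      using \<alpha> pathstart_in_path_image by blast
    have "L (pathstart \<alpha>) 1 = \<alpha> 1"
      by (rule unique[OF L[OF mem], of \<alpha> "pathstart \<alpha>" 0])
        (use L[OF mem] \<alpha> in \<open>auto simp: pathstart_def\<close>)
    with mem show ?thesis
      by (simp add: \<phi>_def pathfinish_def)
  qed
  moreover have "\<exists>\<beta>. path \<beta> \<and> path_image \<beta> \<subseteq> C \<and> pathstart \<beta> = z \<and> pathfinish \<beta> = \<phi> z \<and>
           (\<forall>s\<in>{0..1}. p (\<beta> s) = p (\<alpha> s))" if "z \<in> C" "p z = t" for z
    using L[of z] that by (intro exI[of _ "L z"]) (simp add: \<phi>_def)
  ultimately show ?thesis
    using that by blast
qed

text \<open>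
  In the application \<open>F\<close>, \<open>G\<close>, \<open>H\<close> are the values of \<open>f\<close>, \<open>g\<close>, \<open>f \<circ> g\<close>. Two paths in
  \<open>D\<close> with the same image under \<open>H\<close> have images under \<open>G\<close> that lift one and the same path through
  \<open>F\<close>; these images agree at both ends or at neither. Applied to lifts of \<open>H \<circ> \<alpha>\<close> and to their
  complex conjugates, this yields the two compatibility conditions on the monodromy \<open>\<phi>\<close> that
  \<open>unique_fixed_point_conjugation\<close> requires.
\<close>

lemma block_cnj_invariant:
  fixes H F G :: "complex \<Rightarrow> complex"
  assumes covH: "covering_space D H T" and covF: "covering_space E F T"
    and contG: "continuous_on D G" and GD: "\<And>z. z \<in> D \<Longrightarrow> G z \<in> E"
    and FG: "\<And>z. z \<in> D \<Longrightarrow> F (G z) = H z"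
    and conn: "path_connected D"
    and cnjD: "\<And>z. z \<in> D \<Longrightarrow> cnj z \<in> D" and cnjH: "\<And>z. z \<in> D \<Longrightarrow> H (cnj z) = cnj (H z)"
    and x: "x \<in> D" "cnj x = x" and fin: "finite {z \<in> D. H z = H x}"
    and uniq: "\<And>z. z \<in> D \<Longrightarrow> H z = H x \<Longrightarrow> cnj z = z \<Longrightarrow> z = x"
    and y: "y \<in> D" "G y = G x"
  shows "G (cnj y) = G x"
proof -
  let ?X = "{z \<in> D. H z = H x}"
  have Hy: "H y = H x"
    using FG x y by metis
  have G_ends: "G (pathfinish \<beta>) = G (pathfinish \<beta>') \<longleftrightarrow> G (pathstart \<beta>) = G (pathstart \<beta>')"
    if \<beta>: "path \<beta>" "path_image \<beta> \<subseteq> D" and \<beta>': "path \<beta>'" "path_image \<beta>' \<subseteq> D"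
      and eq: "\<And>s. s \<in> {0..1} \<Longrightarrow> H (\<beta> s) = H (\<beta>' s)" for \<beta> \<beta>'
  proof -
    have cont: "continuous_on {0..1} (K \<circ> \<gamma>)" and im: "K \<circ> \<gamma> \<in> {0..1} \<rightarrow> K ` D"
      if "path \<gamma>" "path_image \<gamma> \<subseteq> D" "continuous_on D K" for \<gamma> and K :: "complex \<Rightarrow> complex"
    proof -
      show "continuous_on {0..1} (K \<circ> \<gamma>)"
        using that unfolding path_def path_image_def
        by (blast intro: continuous_on_compose continuous_on_subset)
      show "K \<circ> \<gamma> \<in> {0..1} \<rightarrow> K ` D"
        using that by (auto simp: path_image_def)
    qed
    note contH = covering_space_imp_continuous[OF covH]
    have G_im: "G \<circ> \<gamma> \<in> {0..1} \<rightarrow> E" and H_im: "H \<circ> \<gamma> \<in> {0..1} \<rightarrow> T"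
      if "path \<gamma>" "path_image \<gamma> \<subseteq> D" for \<gamma>
      using im[OF that contG] im[OF that contH] GD covering_space_imp_surjective[OF covH]
      by (auto simp: Pi_iff)
    have mem: "\<beta> s \<in> D" "\<beta>' s \<in> D" if "s \<in> {0..1}" for s
      using that \<beta> \<beta>' by (auto simp: path_image_def)
    have "(G \<circ> \<beta>) s' = (G \<circ> \<beta>') s'"
      if "s \<in> {0..1}" "s' \<in> {0..1}" "(G \<circ> \<beta>) s = (G \<circ> \<beta>') s" for s s'
      by (rule covering_space_lift_unique[OF covF, of "G \<circ> \<beta>" s "G \<circ> \<beta>'" "{0..1}" "H \<circ> \<beta>"])
        (use that cont[OF _ _ contG] cont[OF _ _ contH] G_im H_im \<beta> \<beta>' FG mem eq in auto)
    from this[of 0 1] this[of 1 0] show ?thesis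
      by (auto simp: pathstart_def pathfinish_def)
  qed
  obtain \<alpha> where \<alpha>: "path \<alpha>" "path_image \<alpha> \<subseteq> D" "pathstart \<alpha> = x" "pathfinish \<alpha> = y"
    using conn x(1) y(1) unfolding path_connected_def by blast
  have H_ends: "H (pathstart \<alpha>) = H x" "H (pathfinish \<alpha>) = H x"
    using \<alpha> Hy by simp_all
  let ?lift = "\<lambda>\<phi> \<beta> z. path \<beta> \<and> path_image \<beta> \<subseteq> D \<and> pathstart \<beta> = z \<and> pathfinish \<beta> = \<phi> z \<and>
      (\<forall>s\<in>{0..1}. H (\<beta> s) = H (\<alpha> s))"
  obtain \<phi> where \<phi>: "\<phi> permutes ?X" "\<phi> x = y"
    and "\<And>z. z \<in> D \<Longrightarrow> H z = H x \<Longrightarrow> \<exists>\<beta>. ?lift \<phi> \<beta> z"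
    using covering_space_monodromy_permutation[OF covH fin \<alpha>(1,2) H_ends] unfolding \<alpha>(3,4) by blast
  then have "\<forall>z\<in>?X. \<exists>\<beta>. ?lift \<phi> \<beta> z"
    by simp
  then obtain L where L: "\<And>z. z \<in> ?X \<Longrightarrow> ?lift \<phi> (L z) z"
    using bchoice[of ?X "\<lambda>z \<beta>. ?lift \<phi> \<beta> z"] by blast
  have cnjX: "cnj z \<in> ?X" if "z \<in> ?X" for z
    using that cnjD[of z] cnjH[of z] cnjH[OF x(1)] x(2) by auto
  have "G (cnj (\<phi> x)) = G x"
  proof (rule unique_fixed_point_conjugation[where X = ?X and c = cnj and \<phi> = \<phi> and g = G])
    show "G (\<phi> z) = G (\<phi> z') \<longleftrightarrow> G z = G z'" if "z \<in> ?X" "z' \<in> ?X" for z z'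
      using G_ends[of "L z" "L z'"] L[OF that(1)] L[OF that(2)] by simp
    show "G (cnj (\<phi> (cnj z))) = G (cnj (\<phi> (cnj z'))) \<longleftrightarrow> G z = G z'"
      if "z \<in> ?X" "z' \<in> ?X" for z z'
    proof -
      define \<beta> where "\<beta> = L (cnj z)"
      define \<beta>' where "\<beta>' = L (cnj z')"
      have \<beta>: "?lift \<phi> \<beta> (cnj z)" and \<beta>': "?lift \<phi> \<beta>' (cnj z')"
        using L[OF cnjX] that unfolding \<beta>_def \<beta>'_def by blast+
      have "path (cnj \<circ> \<beta>)" "path (cnj \<circ> \<beta>')"
        using \<beta> \<beta>' by (auto intro!: path_continuous_image continuous_intros)
      moreover have "path_image (cnj \<circ> \<beta>) \<subseteq> D" "path_image (cnj \<circ> \<beta>') \<subseteq> D"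
        using \<beta> \<beta>' cnjD by (auto simp: path_image_def)
      moreover have "H ((cnj \<circ> \<beta>) s) = H ((cnj \<circ> \<beta>') s)" if "s \<in> {0..1}" for s
      proof -
        have "\<beta> s \<in> D" "\<beta>' s \<in> D"
          using \<beta> \<beta>' that by (auto simp: path_image_def)
        with \<beta> \<beta>' that show ?thesis by (simp add: cnjH)
      qed
      ultimately show ?thesis
        using G_ends[of "cnj \<circ> \<beta>" "cnj \<circ> \<beta>'"] \<beta> \<beta>' by (simp add: pathstart_compose pathfinish_compose)
    qed
  qed (use fin \<phi> x y uniq cnjX in auto)
  with \<phi> show ?thesis by simp
qed

section \<open>Persistence of weak injectivity\<close>

definition homogenize :: "nat \<Rightarrow> complex poly \<Rightarrow> complex \<Rightarrow> complex \<Rightarrow> complex" where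
  "homogenize n p u v = (\<Sum>i\<le>n. coeff p i * u ^ i * v ^ (n - i))"

lemma homogenize_finite:
  assumes "degree p \<le> n" "v \<noteq> 0"
  shows "homogenize n p u v = v ^ n * poly p (u / v)"
proof -
  have "poly p (u / v) = (\<Sum>i\<le>degree p. coeff p i * (u / v) ^ i)"
    by (rule poly_altdef)
  also have "\<dots> = (\<Sum>i\<le>n. coeff p i * (u / v) ^ i)"
    using assms by (intro sum.mono_neutral_left) (auto simp: coeff_eq_0)
  finally have "v ^ n * poly p (u / v) = (\<Sum>i\<le>n. v ^ n * (coeff p i * (u / v) ^ i))"
    by (simp add: sum_distrib_left)
  also have "\<dots> = (\<Sum>i\<le>n. coeff p i * u ^ i * v ^ (n - i))"
    using assms by (intro sum.cong) (auto simp: power_divide power_diff)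
  finally show ?thesis by (simp add: homogenize_def)
qed

lemma homogenize_infinity: "homogenize n p u 0 = coeff p n * u ^ n"
proof -
  have "homogenize n p u 0 = (\<Sum>i\<in>{n}. coeff p i * u ^ i * 0 ^ (n - i))"
    unfolding homogenize_def by (rule sum.mono_neutral_right) auto
  then show ?thesis by simp
qed

text \<open>
  The numerator of \<open>h x - h y\<close>, homogenized in \<open>y\<close>. With \<open>y = u / v\<close> in homogeneous coordinates, the
  point at infinity becomes \<open>v = 0\<close>, and the projective line can be replaced by the compact unit circle.
\<close>

definition cross :: "complex poly fract \<Rightarrow> real \<Rightarrow> real \<times> real \<Rightarrow> complex" where
  "cross h x w =
    (let n = max (degree (num h)) (degree (den h));
         hom = \<lambda>p. homogenize n p (of_real (fst w)) (of_real (snd w))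
     in poly (num h) (of_real x) * hom (den h) - hom (num h) * poly (den h) (of_real x))"

lemma cross_finite:
  assumes "v \<noteq> 0"
  shows "cross h x (u, v) =
    of_real v ^ max (degree (num h)) (degree (den h)) *
    (poly (num h) (of_real x) * poly (den h) (of_real (u / v))
      - poly (num h) (of_real (u / v)) * poly (den h) (of_real x))"
  using assms by (simp add: cross_def Let_def homogenize_finite algebra_simps)

lemma cross_infinity:
  "cross h x (u, 0) =
    of_real u ^ max (degree (num h)) (degree (den h)) *
    (poly (num h) (of_real x) * coeff (den h) (max (degree (num h)) (degree (den h)))
      - coeff (num h) (max (degree (num h)) (degree (den h))) * poly (den h) (of_real x))"
  by (simp add: cross_def Let_def homogenize_infinity algebra_simps)

lemma ratfun_map_eq_if_cross:
  assumes "poly (num h) x * poly (den h) y = poly (num h) y * poly (den h) x"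
  shows "ratfun_map h (Some x) = ratfun_map h (Some y)"
  using assms num_den_no_common_root[of h x] num_den_no_common_root[of h y]
  by (auto simp: ratfun_map_def case_prod_beta frac_eq_eq)

lemma ratfun_map_infinity_eq_if_cross:
  defines "n \<equiv> \<lambda>h. max (degree (num h)) (degree (den h))"
  assumes "poly (num h) x * coeff (den h) (n h) = coeff (num h) (n h) * poly (den h) x"
  shows "ratfun_map h None = ratfun_map h (Some x)"
proof (cases "degree (num h) > degree (den h)")
  case True
  then have "n h = degree (num h)" "coeff (den h) (n h) = 0" "num h \<noteq> 0"
    by (auto simp: n_def coeff_eq_0)
  with assms have "poly (den h) x = 0" by simp
  with True show ?thesis by (simp add: ratfun_map_def case_prod_beta)
next
  case False
  then have n: "n h = degree (den h)"
    by (simp add: n_def)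
  with assms num_den_no_common_root[of h x] have "poly (den h) x \<noteq> 0"
    by auto
  with assms n False show ?thesis
    by (simp add: ratfun_map_def case_prod_beta frac_eq_eq)
qed

text \<open>
  Other real points of the fibre of \<open>h\<close> through \<open>x\<close> are excluded near \<open>z\<^sub>0\<close> because \<open>h\<close> is injective there. The other
  points of the real projective line form a compact part \<open>K\<close> on which \<open>h\<close> avoids the value
  \<open>h z\<^sub>0\<close>; by the tube lemma it avoids \<open>h x\<close> for all \<open>x\<close> near \<open>z\<^sub>0\<close> too. Equality of
  values is cross-multiplied, so that \<open>z\<^sub>0\<close> may be a pole of \<open>h\<close>.
\<close>

lemma weakly_injective_nearby:
  assumes "weakly_injective h"
  obtains z\<^sub>0 \<epsilon> :: real where "\<epsilon> > 0"
    "\<And>x y :: real. \<bar>x - z\<^sub>0\<bar> < \<epsilon> \<Longrightarrow>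
        poly (num h) (of_real x) * poly (den h) (of_real y)
          = poly (num h) (of_real y) * poly (den h) (of_real x) \<Longrightarrow> x = y"
proof -
  let ?n = "max (degree (num h)) (degree (den h))"
  obtain z :: real where ncrit: "\<not> critical_point h (Some (of_real z))"
    and single: "\<And>y. y \<in> extended_reals \<Longrightarrow> y \<noteq> Some (of_real z) \<Longrightarrow>
        ratfun_map h y \<noteq> ratfun_map h (Some (of_real z))"
    using assms by (auto simp: weakly_injective_def Reals_def)
  obtain U where U: "openin riemann_sphere U" "Some (of_real z) \<in> U" "inj_on (ratfun_map h) U"
    using ncrit by (auto simp: critical_point_def)
  have "open (Some -` U)"
  proof -
    consider V where "open V" "U = Some ` V" | C where "closed C" "U = insert None (Some ` (- C))"
      using U(1) by (auto simp: openin_Alexandroff_compactification Compl_eq_Diff_UNIV)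
    then show ?thesis
    proof cases
      case 1
      then show ?thesis by (simp add: inj_vimage_image_eq)
    next
      case 2
      then have "Some -` U = - C" by auto
      with 2 show ?thesis by (simp add: open_Compl)
    qed
  qed
  then obtain \<delta> where \<delta>: "\<delta> > 0" "ball (of_real z) \<delta> \<subseteq> Some -` U"
    using U(2) by (metis openE vimageI2)
  have near: "x = y" if "\<bar>x - z\<bar> < \<delta>" "\<bar>y - z\<bar> < \<delta>"
      "poly (num h) (of_real x) * poly (den h) (of_real y)
          = poly (num h) (of_real y) * poly (den h) (of_real x)" for x y :: real
  proof -
    have "of_real x \<in> ball (of_real z :: complex) \<delta>" "of_real y \<in> ball (of_real z :: complex) \<delta>"
      using that by (simp_all add: dist_of_real dist_real_def abs_minus_commute)
    then have "Some (of_real x) \<in> U" "Some (of_real y) \<in> U"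
      using \<delta>(2) by blast+
    with U(3) ratfun_map_eq_if_cross[OF that(3)] show ?thesis
      by (auto dest: inj_onD)
  qed
  (* The condition says that v = 0 or that u / v has distance at least \<delta> from z. *)
  define K where "K = {w :: real \<times> real. norm w = 1 \<and> \<delta> * \<bar>snd w\<bar> \<le> \<bar>fst w - z * snd w\<bar>}"
  have "compact K"
  proof -
    have "closed {w :: real \<times> real. \<delta> * \<bar>snd w\<bar> \<le> \<bar>fst w - z * snd w\<bar>}"
      by (intro closed_Collect_le continuous_intros)
    then have "compact (sphere 0 1 \<inter> {w :: real \<times> real. \<delta> * \<bar>snd w\<bar> \<le> \<bar>fst w - z * snd w\<bar>})"
      by (intro compact_Int_closed compact_sphere)
    then show ?thesis
      by (simp add: K_def Int_def sphere_def dist_norm)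
  qed
  let ?W = "{q. cross h (fst q) (snd q) \<noteq> 0}"
  have "continuous_on UNIV (\<lambda>q. cross h (fst q) (snd q))"
    unfolding cross_def homogenize_def Let_def by (intro continuous_intros)
  then have "open ?W"
    by (intro open_Collect_neq continuous_intros)
  moreover have "{z} \<times> K \<subseteq> ?W"
  proof clarsimp
    fix u v assume K: "(u, v) \<in> K" and 0: "cross h z (u, v) = 0"
    show False
    proof (cases "v = 0")
      case True
      with K have "u \<noteq> 0" by (auto simp: K_def norm_prod_def)
      with 0 True have "ratfun_map h None = ratfun_map h (Some (of_real z))"
        by (intro ratfun_map_infinity_eq_if_cross) (simp add: cross_infinity)
      with single[of None] show False by (simp add: extended_reals_def)
    next
      case False
      with 0 have "ratfun_map h (Some (of_real z)) = ratfun_map h (Some (of_real (u / v)))"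
        by (intro ratfun_map_eq_if_cross) (simp add: cross_finite)
      moreover have "u / v \<noteq> z"
      proof
        assume "u / v = z"
        with False have "u - z * v = 0" by (simp add: field_simps)
        with K False \<delta>(1) show False by (simp add: K_def mult_le_0_iff)
      qed
      ultimately show False
        using single[of "Some (of_real (u / v))"] by (simp add: extended_reals_def del: of_real_divide)
    qed
  qed
  ultimately have "\<exists>X. z \<in> X \<and> open X \<and> X \<times> K \<subseteq> ?W"
    by (rule Elementary_Topology.tube_lemma[OF \<open>compact K\<close>])
  then obtain X where X: "z \<in> X" "open X" "X \<times> K \<subseteq> ?W"
    by iprover
  obtain \<eta> where \<eta>: "\<eta> > 0" "ball z \<eta> \<subseteq> X"
    using openE[OF X(2,1)] .
  show ?thesis
  proof
    show "min \<delta> \<eta> > 0" using \<delta> \<eta> by simp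
    fix x y :: real
    assume x: "\<bar>x - z\<bar> < min \<delta> \<eta>" and eq: "poly (num h) (of_real x) * poly (den h) (of_real y)
          = poly (num h) (of_real y) * poly (den h) (of_real x)"
    show "x = y"
    proof (cases "\<bar>y - z\<bar> < \<delta>")
      case True
      with x eq near show ?thesis by simp
    next
      case False
      define r where "r = norm (y, 1 :: real)"
      have "r > 0" by (simp add: r_def zero_prod_def)
      have "(y / r, 1 / r) = (1 / r) *\<^sub>R (y, 1 :: real)"
        by simp
      then have "norm (y / r, 1 / r) = 1"
        using \<open>r > 0\<close> by (simp only: norm_scaleR flip: r_def) simp
      moreover have "\<bar>y / r - z * (1 / r)\<bar> = \<bar>y - z\<bar> / r"
        using \<open>r > 0\<close> by (simp add: field_simps flip: diff_divide_distrib)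
      ultimately have "(y / r, 1 / r) \<in> K"
        using False \<open>r > 0\<close> by (simp add: K_def divide_right_mono)
      moreover have "x \<in> X"
        using x \<eta> by (auto simp: dist_real_def abs_minus_commute)
      ultimately have "cross h x (y / r, 1 / r) \<noteq> 0"
        using X(3) by auto
      with eq \<open>r > 0\<close> show ?thesis
        by (simp add: cross_finite)
    qed
  qed
qed

lemma weakly_injective_nonconst:
  assumes "weakly_injective h"
  shows "h \<notin> range const_ratfun"
proof
  assume "h \<in> range const_ratfun"
  then obtain c where h: "h = const_ratfun c" by blast
  obtain z\<^sub>0 \<epsilon> :: real where "\<epsilon> > 0" and sep: "\<And>x y :: real. \<bar>x - z\<^sub>0\<bar> < \<epsilon> \<Longrightarrow>
        poly (num h) (of_real x) * poly (den h) (of_real y)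
          = poly (num h) (of_real y) * poly (den h) (of_real x) \<Longrightarrow> x = y"
    using weakly_injective_nearby[OF assms] by metis
  have "Fract (num h) (den h) = Fract [:c:] 1"
    using h by (simp add: to_fract_def)
  then have "num h * 1 = [:c:] * den h"
    by (metis eq_fract(1) snd_quot_of_fract_nonzero one_neq_zero)
  then have "poly (num h) w = c * poly (den h) w" for w
    by (metis mult.right_neutral mult_pCons_left poly_smult add.right_neutral mult_zero_left pCons_0_0)
  with sep[of z\<^sub>0 "z\<^sub>0 + 1"] \<open>\<epsilon> > 0\<close> show False by simp
qed

section \<open>Reality of rational functions\<close>

text \<open>
  Cross-multiplying with a real fraction shows that \<open>h\<close> equals the fraction with conjugated
  coefficients; in lowest terms, this forces the conjugate of a point that is no pole to be no pole.
\<close>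

lemma real_ratfun_cnj:
  assumes "h \<in> real_ratfuns" "poly (den h) z \<noteq> 0"
  shows "poly (den h) (cnj z) \<noteq> 0 \<and> ratfun_eval h (cnj z) = cnj (ratfun_eval h z)"
proof -
  obtain p q :: "real poly" where h: "h = Fract (map_poly of_real p) (map_poly of_real q)" and "q \<noteq> 0"
    using assms by (auto simp: real_ratfuns_def)
  let ?p = "map_poly complex_of_real p" and ?q = "map_poly complex_of_real q"
  have "?q \<noteq> 0"
    using \<open>q \<noteq> 0\<close> by (simp add: map_poly_eq_0_iff)
  have cnj_poly: "cnj (poly (map_poly complex_of_real s) w) = poly (map_poly of_real s) (cnj w)" for s w
    by (rule poly_cnj_real) (simp add: coeff_map_poly)
  have "Fract (num h) (den h) = Fract ?p ?q"
    using h by simp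
  then have eq: "num h * ?q = ?p * den h"
    using \<open>?q \<noteq> 0\<close> by (metis eq_fract(1) snd_quot_of_fract_nonzero)
  have eqz: "poly (num h) w * poly ?q w = poly ?p w * poly (den h) w" for w
    using eq by (metis poly_mult)
  let ?c = "map_poly cnj"
  have "poly (num h * ?c (den h)) w * poly ?q w = poly (?c (num h) * den h) w * poly ?q w" for w
  proof -
    have "cnj (poly (num h) (cnj w)) * poly ?q w = poly ?p w * cnj (poly (den h) (cnj w))"
      using arg_cong[OF eqz[of "cnj w"], of cnj] by (simp add: cnj_poly)
    then have "poly (num h) w * poly ?q w * cnj (poly (den h) (cnj w))
        = cnj (poly (num h) (cnj w)) * poly ?q w * poly (den h) w"
      using eqz[of w] by (simp only: ac_simps)
    then show ?thesis
      by (simp only: poly_mult poly_map_poly_cnj ac_simps)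
  qed
  then have "num h * ?c (den h) * ?q = ?c (num h) * den h * ?q"
    by (intro poly_eq_poly_eq_iff[THEN iffD1] ext) (simp add: algebra_simps)
  then have "num h * ?c (den h) = ?c (num h) * den h"
    using \<open>?q \<noteq> 0\<close> by simp
  then have sym: "poly (num h) z * cnj (poly (den h) (cnj z)) = cnj (poly (num h) (cnj z)) * poly (den h) z"
    by (metis poly_mult poly_map_poly_cnj)
  then have den: "poly (den h) (cnj z) \<noteq> 0"
    using assms(2) num_den_no_common_root[of h "cnj z"] by auto
  have "cnj (ratfun_eval h (cnj z)) = ratfun_eval h z"
    using sym den assms(2) by (simp add: ratfun_eval_def frac_eq_eq algebra_simps)
  then have "ratfun_eval h (cnj z) = cnj (ratfun_eval h z)"
    by (metis complex_cnj_cnj)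
  with den show ?thesis by blast
qed

lemma real_poly_of_cnj_invariant_roots:
  fixes Z :: "complex set"
  assumes "finite Z" "\<And>z. z \<in> Z \<Longrightarrow> cnj z \<in> Z"
  obtains R :: "real poly" where "(\<Prod>z\<in>Z. [:-z, 1:]) = map_poly of_real R"
proof -
  let ?p = "\<Prod>z\<in>Z. [:-z, 1:]"
  have "poly (map_poly cnj ?p) x = poly ?p x" for x
  proof -
    have "poly (map_poly cnj ?p) x = (\<Prod>z\<in>Z. x - cnj z)"
      by (simp add: poly_prod cnj_prod algebra_simps)
    also have "\<dots> = (\<Prod>z\<in>Z. x - z)"
      by (rule prod.reindex_bij_witness[of _ cnj cnj]) (use assms in auto)
    finally show ?thesis
      by (simp add: poly_prod algebra_simps)
  qed
  then have "map_poly cnj ?p = ?p"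
    by (intro poly_eq_poly_eq_iff[THEN iffD1] ext)
  then have "cnj (coeff ?p i) = coeff ?p i" for i
    by (metis coeff_map_poly complex_cnj_zero)
  then have "of_real (Re (coeff ?p i)) = coeff ?p i" for i
    by (metis Reals_cnj_iff of_real_Re)
  then have "?p = map_poly of_real (map_poly Re ?p)"
    by (intro poly_eqI) (simp add: coeff_map_poly)
  then show ?thesis by (rule that)
qed

lemma MOST_real_point:
  assumes "MOST z :: complex. P z" "\<epsilon> > 0"
  shows "\<exists>x. \<bar>x - z\<^sub>0\<bar> < \<epsilon> \<and> P (of_real x)"
proof (rule ccontr)
  assume "\<not> ?thesis"
  then have "of_real ` {z\<^sub>0 - \<epsilon><..<z\<^sub>0 + \<epsilon>} \<subseteq> {z :: complex. \<not> P z}"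
    by (force simp: abs_less_iff)
  then have "finite (complex_of_real ` {z\<^sub>0 - \<epsilon><..<z\<^sub>0 + \<epsilon>})"
    using assms(1) unfolding MOST_iff_finiteNeg by (rule finite_subset)
  then have "finite {z\<^sub>0 - \<epsilon><..<z\<^sub>0 + \<epsilon>}"
    by (rule finite_imageD) (simp add: inj_on_def)
  then show False
    using assms(2) by (simp add: infinite_Ioo)
qed

text \<open>
  Here \<open>P\<close> expresses that \<open>z\<close> lies over no exceptional value of \<open>h\<close> or of \<open>g\<close>. The
  finitely many points where the pointwise identity \<open>h z = f (g z)\<close> fails are kept out by removing
  their images from the target, so that whole fibres avoid them.
\<close>

lemma level_poly_real_at_generic_points:
  assumes f: "f \<notin> range const_ratfun" and g: "g \<notin> range const_ratfun"
    and real: "ratfun_compose f g \<in> real_ratfuns"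
    and wi: "weakly_injective (ratfun_compose f g)"
  obtains z\<^sub>0 \<epsilon> :: real and P :: "complex \<Rightarrow> bool" where "\<epsilon> > 0" "MOST z. P z"
    "\<And>x :: real. \<bar>x - z\<^sub>0\<bar> < \<epsilon> \<Longrightarrow> P (of_real x) \<Longrightarrow>
       \<exists>a (R :: real poly). level_poly g (ratfun_eval g (of_real x)) = smult a (map_poly of_real R)"
proof -
  define h where "h = ratfun_compose f g"
  have h: "h \<notin> range const_ratfun"
    using weakly_injective_nonconst[OF wi] by (simp add: h_def)
  obtain z\<^sub>0 \<epsilon> :: real where "\<epsilon> > 0" and isolated: "\<And>x y :: real. \<bar>x - z\<^sub>0\<bar> < \<epsilon> \<Longrightarrow>
        poly (num h) (of_real x) * poly (den h) (of_real y)
          = poly (num h) (of_real y) * poly (den h) (of_real x) \<Longrightarrow> x = y"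
    using weakly_injective_nearby[OF wi] unfolding h_def by metis
  define good where "good = (\<lambda>z. poly (den h) z \<noteq> 0 \<and> poly (den g) z \<noteq> 0 \<and>
      ratfun_eval h z = ratfun_eval f (ratfun_eval g z) \<and> poly (den f) (ratfun_eval g z) \<noteq> 0)"
  have "MOST z. poly (den f) (ratfun_eval g z) \<noteq> 0"
    using MOST_ratfun_eval_notin[OF g poly_roots_finite[OF snd_quot_of_fract_nonzero[of f]]] by simp
  then have MOST_good: "MOST z. good z"
    using MOST_ratfun_eval_compose[of f g]
    by (simp add: good_def h_def MOST_conj_distrib MOST_poly_nonzero)
  then have finite_bad: "finite {z. \<not> good z}"
    by (simp add: MOST_iff_finiteNeg)
  define B where "B = ratfun_eval h ` {z. \<not> good z} \<union> {t. \<not> generic_value h t} \<union> {t. \<not> generic_value f t}"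
  (* Closing the exceptional values under conjugation makes D, and the lifts in it, conjugation stable. *)
  define T where "T = - (B \<union> cnj ` B)"
  have "finite B"
    using finite_bad finite_nongeneric_values f h by (simp add: B_def)
  then have finT: "finite (- T)"
    by (simp add: T_def)
  have "open T"
    using finT by (metis finite_imp_closed open_closed)
  have cnjT: "cnj t \<in> T" if "t \<in> T" for t
    using that by (auto simp: T_def image_iff)
  define D where "D = ratfun_preimage h T"
  have D_good: "good z" if "z \<in> D" for z
    using that by (auto simp: D_def ratfun_preimage_def T_def B_def)
  have D_I: "z \<in> D" if "good z" "ratfun_eval h z \<in> T" for z
    using that by (simp add: D_def ratfun_preimage_def good_def)
  have MOST_D: "MOST z. z \<in> D"
  proof -
    have "MOST z. ratfun_eval h z \<notin> - T"
      using MOST_ratfun_eval_notin[OF h finT] .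
    with MOST_good show ?thesis
      by eventually_elim (simp add: D_I)
  qed
  have covh: "covering_space D (ratfun_eval h) T"
    unfolding D_def using h \<open>open T\<close> by (rule covering_space_ratfun_eval) (auto simp: T_def B_def)
  have covf: "covering_space (ratfun_preimage f T) (ratfun_eval f) T"
    using f \<open>open T\<close> by (rule covering_space_ratfun_eval) (auto simp: T_def B_def)
  have "finite (- D)"
    using MOST_D by (simp add: MOST_iff_finiteNeg Compl_eq)
  then have conn: "path_connected D"
    using path_connected_complement_countable[of "- D"] by (simp add: countable_finite)
  have contg: "continuous_on D (ratfun_eval g)"
    using holomorphic_on_imp_continuous_on[OF holomorphic_ratfun_eval]
    by (rule continuous_on_subset) (use D_good in \<open>auto simp: good_def\<close>)
  have g_mem: "ratfun_eval g z \<in> ratfun_preimage f T" and fg: "ratfun_eval f (ratfun_eval g z) = ratfun_eval h z"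
    if "z \<in> D" for z
    using that D_good[OF that] by (auto simp: good_def D_def ratfun_preimage_def)
  have cnj_h: "ratfun_eval h (cnj z) = cnj (ratfun_eval h z)" and cnj_D: "cnj z \<in> D" if "z \<in> D" for z
    using that real_ratfun_cnj[of h z] real cnjT by (auto simp: h_def D_def ratfun_preimage_def)
  define P where "P = (\<lambda>z. z \<in> D \<and> ratfun_eval g z \<notin> ratfun_eval g ` {z. \<not> good z} \<and>
      ratfun_eval g z \<notin> {w. \<not> generic_value g w})"
  have "MOST z. P z"
    unfolding P_def MOST_conj_distrib using MOST_D finite_bad finite_nongeneric_values[OF g] g
    by (intro conjI MOST_ratfun_eval_notin) auto
  moreover have "\<exists>a (R :: real poly). level_poly g (ratfun_eval g (of_real x)) = smult a (map_poly of_real R)"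
    if x: "\<bar>x - z\<^sub>0\<bar> < \<epsilon>" "P (of_real x)" for x :: real
  proof -
    let ?x = "complex_of_real x"
    let ?w = "ratfun_eval g ?x"
    let ?Z = "{z. poly (level_poly g ?w) z = 0}"
    have xD: "?x \<in> D" and generic: "generic_value g ?w"
      using x by (auto simp: P_def)
    have Z_D: "z \<in> D" if "z \<in> ?Z" for z
    proof (rule D_I)
      have z: "ratfun_eval g z = ?w"
        using that by (simp add: level_poly_root_iff)
      then show "good z"
        using x(2) by (force simp: P_def image_iff)
      then have "ratfun_eval h z = ratfun_eval h ?x"
        using z fg[OF xD] by (simp add: good_def)
      then show "ratfun_eval h z \<in> T"
        using xD by (simp add: D_def ratfun_preimage_def)
    qed
    have unique_real: "z = ?x" if "z \<in> D" "ratfun_eval h z = ratfun_eval h ?x" "cnj z = z" for z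
    proof -
      have z: "z = of_real (Re z)"
        using that by (metis Reals_cnj_iff of_real_Re)
      have "poly (den h) z \<noteq> 0" "poly (den h) ?x \<noteq> 0"
        using D_good[OF that(1)] D_good[OF xD] by (auto simp: good_def)
      with that(2) have "poly (num h) ?x * poly (den h) z = poly (num h) z * poly (den h) ?x"
        by (simp add: ratfun_eval_def frac_eq_eq)
      with z isolated[OF x(1), of "Re z"] show ?thesis by metis
    qed
    have "finite {z. poly (level_poly h (ratfun_eval h ?x)) z = 0}"
      using level_poly_nonzero[OF h] by (rule poly_roots_finite)
    then have fin: "finite {z \<in> D. ratfun_eval h z = ratfun_eval h ?x}"
      by (rule rev_finite_subset) (auto simp: level_poly_root_iff D_def ratfun_preimage_def)
    have cnj_Z: "cnj z \<in> ?Z" if "z \<in> ?Z" for z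
    proof -
      have "ratfun_eval g (cnj z) = ?w"
        by (rule block_cnj_invariant[OF covh covf contg g_mem fg conn cnj_D cnj_h xD _ fin unique_real Z_D])
          (use that in \<open>auto simp: level_poly_root_iff\<close>)
      moreover have "poly (den g) (cnj z) \<noteq> 0"
        using D_good[OF cnj_D[OF Z_D[OF that]]] by (simp add: good_def)
      ultimately show ?thesis
        by (simp add: level_poly_root_iff)
    qed
    have "finite ?Z"
      using level_poly_nonzero[OF g] by (rule poly_roots_finite)
    then obtain R :: "real poly" where R: "(\<Prod>z\<in>?Z. [:-z, 1:]) = map_poly of_real R"
      using real_poly_of_cnj_invariant_roots cnj_Z by metis
    have "level_poly g ?w = smult (lead_coeff (level_poly g ?w)) (map_poly of_real R)"
      using complex_poly_decompose_rsquarefree[of "level_poly g ?w"] generic R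
      by (simp add: generic_value_def)
    then show ?thesis by blast
  qed
  ultimately show ?thesis
    using that \<open>\<epsilon> > 0\<close> by blast
qed

theorem theorem1p5:
  fixes f g :: "complex poly fract"
  assumes "f \<notin> range const_ratfun"
    and "g \<notin> range const_ratfun"
    and "ratfun_compose f g \<in> real_ratfuns"
    and "weakly_injective (ratfun_compose f g)"
  shows "\<exists>l. linear_fractional l \<and> ratfun_compose l g \<in> real_ratfuns"
proof -
  note g = \<open>g \<notin> range const_ratfun\<close>
  obtain z\<^sub>0 \<epsilon> :: real and P :: "complex \<Rightarrow> bool" where "\<epsilon> > 0" and P: "MOST z. P z"
    and level: "\<And>x :: real. \<bar>x - z\<^sub>0\<bar> < \<epsilon> \<Longrightarrow> P (of_real x) \<Longrightarrow>
       \<exists>a (R :: real poly). level_poly g (ratfun_eval g (of_real x)) = smult a (map_poly of_real R)"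
    by (rule level_poly_real_at_generic_points[OF assms]) (rule that; assumption)
  obtain x where x: "\<bar>x - z\<^sub>0\<bar> < \<epsilon>" "P (of_real x)"
    using MOST_real_point[OF P \<open>\<epsilon> > 0\<close>] by blast
  have "MOST z. P z \<and> ratfun_eval g z \<noteq> ratfun_eval g (of_real x)"
    using P MOST_ratfun_eval_neq[OF g] by (simp add: MOST_conj_distrib)
  from MOST_real_point[OF this \<open>\<epsilon> > 0\<close>] obtain y where
    y: "\<bar>y - z\<^sub>0\<bar> < \<epsilon>" "P (of_real y)" "ratfun_eval g (of_real y) \<noteq> ratfun_eval g (of_real x)"
    by blast
  define u where "u = ratfun_eval g (of_real x)"
  define v where "v = ratfun_eval g (of_real y)"
  have "u \<noteq> v" using y by (simp add: u_def v_def)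
  obtain a b and R S :: "real poly"
    where R: "level_poly g u = smult a (map_poly of_real R)"
      and S: "level_poly g v = smult b (map_poly of_real S)"
    using level[OF x] level[OF y(1,2)] unfolding u_def v_def by blast
  have "a \<noteq> 0" "b \<noteq> 0" "S \<noteq> 0"
    using R S level_poly_nonzero[OF g, of u] level_poly_nonzero[OF g, of v] by auto
  (* This is (b / a) (z - u) / (z - v); the factor b / a cancels the constant factors of the two level polynomials. *)
  define l where "l = Fract [:- b * u, b:] [:- a * v, a:]"
  have "b * (- a * v) - (- b * u) * a = a * b * (u - v)"
    by (simp add: algebra_simps)
  then have "linear_fractional l"
    unfolding linear_fractional_def l_def using \<open>a \<noteq> 0\<close> \<open>b \<noteq> 0\<close> \<open>u \<noteq> v\<close>
    by (intro exI[of _ b] exI[of _ "- b * u"] exI[of _ a] exI[of _ "- a * v"]) simp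
  moreover have "ratfun_compose l g = Fract (map_poly of_real R) (map_poly of_real S)"
  proof (rule ratfun_eqI)
    have "MOST z. poly (den g) z \<noteq> 0"
      by (simp add: MOST_poly_nonzero)
    with MOST_ratfun_eval_compose[of l g] MOST_ratfun_eval_neq[OF g, of v]
    show "MOST z. ratfun_eval (ratfun_compose l g) z
             = ratfun_eval (Fract (map_poly of_real R) (map_poly of_real S)) z"
    proof eventually_elim
      case (elim z)
      let ?G = "ratfun_eval g z"
      have lev: "poly (level_poly g t) z = poly (den g) z * (?G - t)" for t
        using elim by (simp add: level_poly_def ratfun_eval_def field_simps)
      have Rz: "a * poly (map_poly of_real R) z = poly (den g) z * (?G - u)"
        using lev[of u] R by simp
      have Sz: "b * poly (map_poly of_real S) z = poly (den g) z * (?G - v)"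
        using lev[of v] S by simp
      have "poly (map_poly of_real S) z \<noteq> 0"
        using Sz elim \<open>b \<noteq> 0\<close> by auto
      then have "ratfun_eval (Fract (map_poly of_real R) (map_poly of_real S)) z
          = (b * (a * poly (map_poly of_real R) z)) / (a * (b * poly (map_poly of_real S) z))"
        using \<open>a \<noteq> 0\<close> \<open>b \<noteq> 0\<close> by (simp add: ratfun_eval_Fract)
      also have "\<dots> = (b * (?G - u)) / (a * (?G - v))"
        unfolding Rz Sz using elim by simp
      also have "\<dots> = ratfun_eval l ?G"
        unfolding l_def using elim \<open>a \<noteq> 0\<close> by (subst ratfun_eval_Fract) (auto simp: algebra_simps)
      finally show ?case using elim by simp
    qed
  qed
  then have "ratfun_compose l g \<in> real_ratfuns"
    using \<open>S \<noteq> 0\<close> by (auto simp: real_ratfuns_def)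
  ultimately show ?thesis by blast
qed

end
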